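(* Let $n\ge1$, $\delta>0$ and $\nu\in\mathbb{R}^n$ with $\nu\ne0$. Then the function $\beta\mapsto m^{\delta,\beta}(\nu)$ is monotonically decreasing for $\beta\in\left(\frac{n+4}{2},\,n+4\right)$.
   Context: For $\beta<n+4$ and $\nu\in\mathbb{R}^n$, $$m^{\delta,\beta}(\nu)=-\|\nu\|^2\,{}_2F_3\!\left(1,\tfrac{n+2-\beta}{2};2,\tfrac{n+2}{2},\tfrac{n+4-\beta}{2};-\tfrac14\|\nu\|^2\delta^2\right),$$ where ${}_2F_3(a_1,a_2;b_1,b_2,b_3;z)=\sum_{j\ge0}\frac{(a_1)_j(a_2)_j}{(b_1)_j(b_2)_j(b_3)_j}\frac{z^j}{j!}$ and $(a)_j=a(a+1)\cdots(a+j-1)$ is the rising factorial. *)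

theory Defs
  imports "HOL-Analysis.Analysis" "HOL-Real_Asymp.Real_Asymp"
begin

definition hyp2F3 :: "real \<Rightarrow> real \<Rightarrow> real \<Rightarrow> real \<Rightarrow> real \<Rightarrow> real \<Rightarrow> real" where
  "hyp2F3 a1 a2 b1 b2 b3 z =
     (\<Sum>j. (pochhammer a1 j * pochhammer a2 j)
            / (pochhammer b1 j * pochhammer b2 j * pochhammer b3 j) * (z ^ j / fact j))"

lemma summable_hyp2F3:
  "summable (\<lambda>j. (pochhammer a1 j * pochhammer a2 j)
            / (pochhammer b1 j * pochhammer b2 j * pochhammer b3 j) * (z ^ j / fact j) :: real)"
    (is "summable ?f")
proof -
  let ?r = "\<lambda>j::nat. ((a1 + j) * (a2 + j)) / ((b1 + j) * (b2 + j) * (b3 + j)) * (z / (j + 1))"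
  have "?r \<longlonglongrightarrow> 0"
    by real_asymp
  then have "eventually (\<lambda>j. norm (?r j) < 1/2) sequentially"
    using order_tendstoD(2)[OF tendsto_norm_zero, of ?r sequentially "1/2"] by simp
  then obtain N where N: "\<And>j. j \<ge> N \<Longrightarrow> norm (?r j) < 1/2"
    by (auto simp: eventually_sequentially)
  have step: "?f (Suc j) = ?r j * ?f j" for j
    by (simp add: pochhammer_Suc divide_inverse mult_ac add_ac)
  have "norm (?f (Suc j)) \<le> 1/2 * norm (?f j)" if "j \<ge> N" for j
    unfolding step norm_mult[of "?r j"]
    using N[OF that] by (intro mult_right_mono) auto
  then show ?thesis
    by (intro summable_ratio_test[of "1/2" N]) auto
qed

text \<open>
  The dimension \<open>n\<close> is \<open>CARD('n)\<close>. The formula is meant for \<open>\<beta> < n + 4\<close>, where no denominator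
  vanishes; for other \<open>\<beta>\<close> the value is not meaningful.
\<close>

definition multiplier :: "real \<Rightarrow> real \<Rightarrow> real ^ 'n \<Rightarrow> real" where
  "multiplier \<delta> \<beta> \<nu> =
     - (norm \<nu>)\<^sup>2 *
       hyp2F3 1 ((real CARD('n) + 2 - \<beta>) / 2)
              2 ((real CARD('n) + 2) / 2) ((real CARD('n) + 4 - \<beta>) / 2)
              (- (1 / 4) * (norm \<nu>)\<^sup>2 * \<delta>\<^sup>2)"

end

theory Submission
  imports Defs
begin

text \<open>
  Put \<open>b = (n + 4 - \<beta>) / 2\<close> and \<open>a = n / 2 + 2\<close>, so that \<open>0 < b < a / 2\<close>. Since
  \<open>(b - 1)\<^sub>j / (b)\<^sub>j = (b - 1) / (b - 1 + j)\<close>, the difference of the hypergeometric values at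
  \<open>b\<^sub>1 < b\<^sub>2\<close> is a positive multiple of
  \<open>\<Sum>k. (-y)\<^sup>k / (k! (a)\<^sub>k (k + b\<^sub>1) (k + b\<^sub>2) (k + 2))\<close> with \<open>y > 0\<close>.
  A factor \<open>1 / (k + b)\<close> amounts to integration against \<open>t\<^sup>b\<^sup>-\<^sup>1\<close> and preserves positivity, so it is
  enough to treat \<open>\<Sum>k. (-y)\<^sup>k / (k! (a)\<^sub>k (k + b\<^sub>1))\<close>, and the case \<open>b\<^sub>1 < a / 2\<close> of this follows
  from the case \<open>b\<^sub>1 = a / 2\<close> (essentially \<open>\<integral>\<^sub>0\<^sup>x J\<^sub>a\<^sub>-\<^sub>1 \<ge> 0\<close>). The latter series is a Beta average of
  squares of Bessel functions: with \<open>c = (a + 1) / 2\<close> one has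
  \<open>\<^sub>0F\<^sub>1(c; z)\<^sup>2 = \<^sub>1F\<^sub>2(a/2; c, a; 4z)\<close>, and averaging \<open>z \<mapsto> tz\<close> over the weight
  \<open>t\<^sup>c\<^sup>-\<^sup>1 (1 - t)\<^sup>-\<^sup>1\<^sup>/\<^sup>2\<close> turns \<open>(c)\<^sub>k\<close> into \<open>(a/2 + 1)\<^sub>k\<close>.
\<close>

section \<open>Entire power series, and dividing the k-th coefficient by
  \<open>k + b\<close>\<close>

definition entire_coeffs :: "(nat \<Rightarrow> real) \<Rightarrow> bool" where
  "entire_coeffs c \<longleftrightarrow> (\<forall>y. summable (\<lambda>k. c k * y ^ k))"

lemma entire_coeffs_abs:
  assumes "entire_coeffs c"
  shows "summable (\<lambda>k. \<bar>c k * y ^ k\<bar>)"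
  using powser_insidea[of c "\<bar>y\<bar> + 1" y] assms by (auto simp: entire_coeffs_def)

lemma entire_coeffs_bound:
  assumes "entire_coeffs c" and "\<And>k. \<bar>d k\<bar> \<le> C * \<bar>c k\<bar>"
  shows "entire_coeffs d"
  unfolding entire_coeffs_def
proof
  fix y :: real
  have "summable (\<lambda>k. C * \<bar>c k * y ^ k\<bar>)"
    by (intro summable_mult entire_coeffs_abs assms)
  then show "summable (\<lambda>k. d k * y ^ k)"
  proof (rule summable_comparison_test')
    fix k :: nat
    show "norm (d k * y ^ k) \<le> C * \<bar>c k * y ^ k\<bar>"
      using mult_right_mono[OF assms(2)[of k], of "\<bar>y ^ k\<bar>"] by (simp add: abs_mult mult.assoc)
  qed
qed

lemma entire_coeffs_divide:
  assumes "entire_coeffs c" "b > 0"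
  shows "entire_coeffs (\<lambda>k. c k / (real k + b))"
proof (rule entire_coeffs_bound[OF assms(1)])
  fix k
  have "\<bar>c k\<bar> / (real k + b) \<le> \<bar>c k\<bar> / b"
    using assms(2) by (intro divide_left_mono) auto
  then show "\<bar>c k / (real k + b)\<bar> \<le> (1 / b) * \<bar>c k\<bar>"
    using assms(2) by simp
qed

text \<open>
  With \<open>g\<close> the given series and \<open>D\<close> the new one, \<open>x\<^sup>b D(x)\<close> has derivative \<open>x\<^sup>b\<^sup>-\<^sup>1 g(x) \<ge> 0\<close>,
  and \<open>D(0) > 0\<close>.
\<close>

lemma powser_divide_pos:
  fixes c :: "nat \<Rightarrow> real"
  assumes c: "entire_coeffs c" and b: "b > 0" and "c 0 > 0"
    and nonneg: "\<And>y. y \<ge> 0 \<Longrightarrow> (\<Sum>k. c k * y ^ k) \<ge> 0"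
    and "y \<ge> 0"
  shows "(\<Sum>k. c k / (real k + b) * y ^ k) > 0"
proof -
  define d where "d = (\<lambda>k. c k / (real k + b))"
  define D where "D = (\<lambda>y. \<Sum>k. d k * y ^ k)"
  define D' where "D' = (\<lambda>y. \<Sum>k. diffs d k * y ^ k)"
  have d: "summable (\<lambda>k. d k * y ^ k)" for y
    using entire_coeffs_divide[OF c b] by (simp add: entire_coeffs_def d_def)
  have D_deriv: "(D has_field_derivative D' y) (at y)" for y
    unfolding D_def D'_def by (rule termdiffs_strong_converges_everywhere[OF d])
  \<comment> \<open>Termwise this is \<open>(k + b) * d k = c k\<close>: the Euler operator undoes
    the division.\<close>
  have euler: "b * D y + y * D' y = (\<Sum>k. c k * y ^ k)" for y
  proof -
    have "summable (\<lambda>k. diffs d k * y ^ k)"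
      by (rule termdiff_converges_all[OF d])
    from sums_mult[OF diffs_equiv[OF this], of y]
    have "(\<lambda>k. y * (real k * d k * y ^ (k - Suc 0))) sums (y * D' y)"
      by (simp add: D'_def)
    moreover have "y * (real k * d k * y ^ (k - Suc 0)) = real k * d k * y ^ k" for k
      by (cases k) auto
    ultimately have "(\<lambda>k. real k * d k * y ^ k) sums (y * D' y)" by simp
    moreover have "(\<lambda>k. b * (d k * y ^ k)) sums (b * D y)"
      unfolding D_def by (intro sums_mult summable_sums d)
    ultimately have "(\<lambda>k. b * (d k * y ^ k) + real k * d k * y ^ k) sums (b * D y + y * D' y)"
      by (rule sums_add[rotated])
    moreover have "b * (d k * y ^ k) + real k * d k * y ^ k = c k * y ^ k" for k
    proof -
      have "real k + b \<noteq> 0" using b by (simp add: add_nonneg_pos less_imp_neq[symmetric])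
      then have "c k = (real k + b) * d k" by (simp add: d_def)
      then show ?thesis by (simp add: algebra_simps)
    qed
    ultimately show ?thesis by (simp add: sums_iff)
  qed
  have "D 0 = c 0 / b"
    unfolding D_def by (simp only: powser_zero) (simp add: d_def)
  then have "D 0 > 0" using assms by simp
  moreover have "isCont D 0" using D_deriv DERIV_isCont by blast
  ultimately have "eventually (\<lambda>x. D x > 0) (nhds 0)"
    using order_tendstoD(1)[of D "D 0" "nhds 0" 0] by (simp add: isCont_def tendsto_at_iff_tendsto_nhds)
  then obtain e where e: "e > 0" "\<And>x. \<bar>x\<bar> < e \<Longrightarrow> D x > 0"
    by (auto simp: eventually_nhds_metric dist_real_def)
  have "D y > 0"
  proof (cases "y < e")
    case True
    then show ?thesis using e \<open>y \<ge> 0\<close> by simp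
  next
    case False
    \<comment> \<open>\<open>H\<close> vanishes at 0, so monotonicity from 0 would only give
      \<open>D y \<ge> 0\<close>. Starting at \<open>e / 2\<close>, where \<open>D\<close> is
      already positive, keeps the inequality strict.\<close>
    define H where "H = (\<lambda>x. x powr b * D x)"
    have "H (e / 2) \<le> H y"
    proof (rule DERIV_nonneg_imp_nondecreasing[where f = H])
      show "e / 2 \<le> y" using False e(1) by simp
      fix x assume x: "e / 2 \<le> x" "x \<le> y"
      then have "x > 0" using e(1) by simp
      have pw: "x powr b = x * x powr (b - 1)"
        using \<open>x > 0\<close> by (simp add: powr_diff)
      have "(H has_field_derivative b * x powr (b - 1) * D x + D' x * x powr b) (at x)"
        unfolding H_def
        by (rule DERIV_mult[OF has_real_derivative_powr[OF \<open>x > 0\<close>] D_deriv])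
      also have "b * x powr (b - 1) * D x + D' x * x powr b = x powr (b - 1) * (b * D x + x * D' x)"
        unfolding pw by (simp add: algebra_simps)
      finally have *: "(H has_field_derivative x powr (b - 1) * (b * D x + x * D' x)) (at x)" .
      show "\<exists>l. (H has_real_derivative l) (at x) \<and> l \<ge> 0"
      proof (intro exI conjI)
        show "x powr (b - 1) * (b * D x + x * D' x) \<ge> 0"
          using nonneg[of x] \<open>x > 0\<close> by (simp add: euler)
      qed (rule *)
    qed
    moreover have "H (e / 2) > 0" using e by (simp add: H_def)
    ultimately have "H y > 0" by simp
    then show ?thesis using False e(1) by (simp add: H_def zero_less_mult_iff)
  qed
  then show ?thesis by (simp add: D_def d_def)
qed

text \<open>The sum is the integral of \<open>w\<close> times the series. No interchange of limits
  is needed: convergence is uniform, so late partial sums are at least \<open>-e\<close> on the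
  interval, and integrating this finite bound against \<open>w\<close> suffices, even for an
  unbounded \<open>w\<close>.\<close>

lemma moment_transform_nonneg:
  fixes c \<mu> :: "nat \<Rightarrow> real"
  assumes w: "\<And>t. t \<in> {0..1} \<Longrightarrow> w t \<ge> 0"
    and \<mu>: "\<And>k. ((\<lambda>t. w t * t ^ k) has_integral \<mu> k) {0..1}"
    and c: "summable (\<lambda>k. \<bar>c k\<bar>)" and c\<mu>: "summable (\<lambda>k. c k * \<mu> k)"
    and nonneg: "\<And>t. t \<in> {0..1} \<Longrightarrow> (\<Sum>k. c k * t ^ k) \<ge> 0"
  shows "(\<Sum>k. c k * \<mu> k) \<ge> 0"
proof -
  have unif: "uniform_limit {0..1} (\<lambda>N t. \<Sum>k<N. c k * t ^ k) (\<lambda>t. \<Sum>k. c k * t ^ k) sequentially"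
  proof (rule Weierstrass_m_test[OF _ c])
    fix k and t :: real assume "t \<in> {0..1}"
    then show "norm (c k * t ^ k) \<le> \<bar>c k\<bar>"
      by (simp add: abs_mult mult_left_le power_le_one)
  qed
  have \<mu>0: "\<mu> 0 \<ge> 0"
    by (rule has_integral_nonneg[OF \<mu>]) (use w in auto)
  have bound: "(\<Sum>k. c k * \<mu> k) \<ge> - (e * \<mu> 0)" if "e > 0" for e
  proof (rule tendsto_lowerbound[OF summable_LIMSEQ[OF c\<mu>]])
    show "eventually (\<lambda>N. - (e * \<mu> 0) \<le> (\<Sum>k<N. c k * \<mu> k)) sequentially"
      using uniform_limitD[OF unif that]
    proof eventually_elim
      case (elim N)
      have "((\<lambda>t. (- e) * (w t * t ^ 0)) has_integral (- e) * \<mu> 0) {0..1}"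
        by (intro has_integral_mult_right \<mu>)
      moreover have "((\<lambda>t. \<Sum>k<N. c k * (w t * t ^ k)) has_integral (\<Sum>k<N. c k * \<mu> k)) {0..1}"
        by (intro has_integral_sum has_integral_mult_right \<mu>) auto
      ultimately have "(- e) * \<mu> 0 \<le> (\<Sum>k<N. c k * \<mu> k)"
      proof (rule has_integral_le)
        fix t :: real assume t: "t \<in> {0..1}"
        have "- e \<le> (\<Sum>k<N. c k * t ^ k)"
          using elim t nonneg[OF t] by (force simp: dist_real_def)
        from mult_left_mono[OF this w[OF t]]
        show "(- e) * (w t * t ^ 0) \<le> (\<Sum>k<N. c k * (w t * t ^ k))"
          by (simp add: sum_distrib_left mult_ac)
      qed
      then show ?case by simp
    qed
  qed simp
  have "0 \<le> (\<Sum>k. c k * \<mu> k) + e" if "e > 0" for e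
  proof -
    \<comment> \<open>The denominator \<open>\<mu> 0 + 1\<close> also covers the case
      \<open>\<mu> 0 = 0\<close>.\<close>
    have "e / (\<mu> 0 + 1) * \<mu> 0 \<le> e"
      using that \<mu>0 by (simp add: field_simps)
    moreover have "e / (\<mu> 0 + 1) > 0" using that \<mu>0 by simp
    ultimately show ?thesis using bound[of "e / (\<mu> 0 + 1)"] by linarith
  qed
  then show ?thesis by (rule field_le_epsilon)
qed

section \<open>The square of 0F1 as a power series\<close>

lemma sum_inverse_pochhammer_product:
  fixes c :: real
  assumes "c > 0"
  shows "(\<Sum>i\<le>k. 1 / (fact i * pochhammer c i) * (1 / (fact (k - i) * pochhammer c (k - i))))
         = pochhammer (2 * c - 1 + k) k / (fact k * (pochhammer c k)\<^sup>2)"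
proof -
  have pos: "pochhammer c i > 0" for i by (rule pochhammer_pos[OF assms])
  \<comment> \<open>Up to the factor \<open>(pochhammer c k)\<^sup>2\<close>, each summand is the
    product of the i-th and (k-i)-th binomial coefficients with common upper index
    \<open>c + k - 1\<close>, so Vandermonde evaluates the sum.\<close>
  have choose: "(c + k - 1) gchoose i = pochhammer c k / (fact i * pochhammer c (k - i))" if "i \<le> k" for i
  proof -
    have "pochhammer c k = pochhammer c (k - i) * pochhammer (c + real (k - i)) i"
      using pochhammer_product[of "k - i" k c] that by simp
    moreover have "(c + k - 1) gchoose i = pochhammer (c + real (k - i)) i / fact i"
      using that by (simp add: gbinomial_pochhammer' of_nat_diff algebra_simps)
    ultimately show ?thesis using pos[of "k - i"] by simp
  qed
  have "(2 * c - 1 + k - 1 + k) gchoose k = (\<Sum>i\<le>k. ((c + k - 1) gchoose i) * ((c + k - 1) gchoose (k - i)))"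
    using gbinomial_Vandermonde[of "c + k - 1" "c + k - 1" k] by (simp add: atMost_atLeast0 algebra_simps)
  also have "\<dots> = (\<Sum>i\<le>k. (pochhammer c k)\<^sup>2 *
      (1 / (fact i * pochhammer c i) * (1 / (fact (k - i) * pochhammer c (k - i)))))"
    by (intro sum.cong refl) (simp add: choose power2_eq_square)
  also have "(2 * c - 1 + k - 1 + k) gchoose k = pochhammer (2 * c - 1 + k) k / fact k"
    by (simp add: gbinomial_pochhammer' algebra_simps)
  finally show ?thesis
    unfolding sum_distrib_left[symmetric] using pos[of k] by (simp add: divide_simps mult_ac)
qed

text \<open>Coefficients of 0F1(a; -y), sign included. At \<open>y = x\<^sup>2 / 4\<close> the
  series is a power of x times the Bessel function of order a - 1, up to a constant.\<close>

definition hyp0F1_coeff :: "real \<Rightarrow> nat \<Rightarrow> real" where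
  "hyp0F1_coeff a k = (- 1) ^ k / (fact k * pochhammer a k)"

lemma entire_coeffs_hyp0F1:
  assumes "a > 0"
  shows "entire_coeffs (hyp0F1_coeff a)"
  unfolding entire_coeffs_def
proof
  fix y :: real
  have "pochhammer 1 k > (0::real)" for k by (rule pochhammer_pos) simp
  then have [simp]: "pochhammer 1 k \<noteq> (0::real)" for k by (metis less_irrefl)
  \<comment> \<open>Since \<open>pochhammer 1 k\<close> is k!, cancelling parameters equal to 1
    makes 0F1 an instance of 2F3.\<close>
  have "hyp0F1_coeff a k * y ^ k = (pochhammer 1 k * pochhammer 1 k)
            / (pochhammer 1 k * pochhammer 1 k * pochhammer a k) * ((- y) ^ k / fact k)" for k
    by (simp add: hyp0F1_coeff_def power_minus[of y])
  then show "summable (\<lambda>k. hyp0F1_coeff a k * y ^ k)"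
    using summable_hyp2F3[of 1 1 1 1 a "- y"] by simp
qed

text \<open>Cauchy product. Keeping \<open>pochhammer (2 * c - 1 + k) k\<close> avoids a quotient by
  \<open>pochhammer (2 * c - 1) k\<close>, which vanishes for c = 1/2 and k > 0.\<close>

lemma hyp0F1_square_series:
  fixes c y :: real
  assumes "c > 0"
  shows "(\<lambda>k. (- 1) ^ k * pochhammer (2 * c - 1 + k) k / (fact k * (pochhammer c k)\<^sup>2) * y ^ k)
           sums (\<Sum>k. hyp0F1_coeff c k * y ^ k)\<^sup>2"
proof -
  let ?u = "\<lambda>k. hyp0F1_coeff c k * y ^ k"
  have "summable (\<lambda>k. norm (?u k))"
    using entire_coeffs_abs[OF entire_coeffs_hyp0F1[OF assms]] by simp
  from Cauchy_product_sums[OF this this]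
  have "(\<lambda>k. \<Sum>i\<le>k. ?u i * ?u (k - i)) sums (\<Sum>k. ?u k)\<^sup>2"
    by (simp add: power2_eq_square)
  moreover have "(\<Sum>i\<le>k. ?u i * ?u (k - i)) =
      (- 1) ^ k * pochhammer (2 * c - 1 + k) k / (fact k * (pochhammer c k)\<^sup>2) * y ^ k" for k
  proof -
    have "?u i * ?u (k - i) = (- y) ^ k *
       (1 / (fact i * pochhammer c i) * (1 / (fact (k - i) * pochhammer c (k - i))))" if "i \<le> k" for i
    proof -
      have "(- y) ^ k = (- y) ^ i * (- y) ^ (k - i)"
        using that by (simp flip: power_add)
      then show ?thesis by (simp add: hyp0F1_coeff_def power_minus[of y])
    qed
    then have "(\<Sum>i\<le>k. ?u i * ?u (k - i)) = (- y) ^ k *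
      (\<Sum>i\<le>k. 1 / (fact i * pochhammer c i) * (1 / (fact (k - i) * pochhammer c (k - i))))"
      by (simp add: sum_distrib_left)
    then show ?thesis
      unfolding sum_inverse_pochhammer_product[OF assms] by (simp add: power_minus[of y])
  qed
  ultimately show ?thesis by simp
qed

section \<open>Positivity of the 0F1 series with divided coefficients\<close>

lemma hyp0F1_integral_nonneg:
  fixes a y :: real
  assumes a: "a > 0" and y: "y \<ge> 0"
  shows "(\<Sum>k. hyp0F1_coeff a k / (real k + a / 2) * y ^ k) \<ge> 0"
proof -
  define c where "c = (a + 1) / 2"
  have c: "c > 0" "2 * c - 1 = a" "c - 1 / 2 = a / 2" using a by (auto simp: c_def field_simps)
  \<comment> \<open>These are the coefficients of 1F2(a/2; c, a; -x), that is, of the square of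
    0F1(c; -x/4).\<close>
  define s where "s = (\<lambda>k. hyp0F1_coeff a k * (pochhammer (a / 2) k / pochhammer c k))"
  define \<mu> where "\<mu> = (\<lambda>k. Beta (c + real k) (1 / 2))"
  have pos: "pochhammer a k > 0" "pochhammer c k > 0" "pochhammer (a / 2) k > 0"
    "pochhammer (a / 2 + 1) k > 0" for k
    using a c(1) by (simp_all add: pochhammer_pos)
  \<comment> \<open>Duplication splits \<open>pochhammer a (2 * k)\<close> into factors at a/2 and
    c; splitting it at index k instead yields \<open>pochhammer (a + k) k\<close>.\<close>
  have s_eq: "4 ^ k * s k = (- 1) ^ k * pochhammer (2 * c - 1 + k) k / (fact k * (pochhammer c k)\<^sup>2)" for k
  proof -
    have "pochhammer a (2 * k) = 4 ^ k * pochhammer (a / 2) k * pochhammer c k"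
      using pochhammer_double[of "a / 2" k] by (simp add: c_def power_mult add_divide_distrib)
    moreover have "pochhammer a (2 * k) = pochhammer a k * pochhammer (a + k) k"
      using pochhammer_product[of k "2 * k" a] by simp
    ultimately have "pochhammer (a + k) k = 4 ^ k * pochhammer (a / 2) k * pochhammer c k / pochhammer a k"
      using pos(1)[of k] by (simp add: field_simps)
    then show ?thesis
      unfolding c(2) s_def hyp0F1_coeff_def using pos[of k] by (simp add: field_simps power2_eq_square)
  qed
  have s: "entire_coeffs s"
  proof (rule entire_coeffs_bound[OF entire_coeffs_hyp0F1[OF a], of _ 1])
    fix k
    have "pochhammer (a / 2) k \<le> pochhammer c k"
      unfolding pochhammer_prod using a by (intro prod_mono) (auto simp: c_def)
    then have "\<bar>pochhammer (a / 2) k / pochhammer c k\<bar> \<le> 1"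
      using pos[of k] by simp
    from mult_left_mono[OF this, of "\<bar>hyp0F1_coeff a k\<bar>"]
    show "\<bar>s k\<bar> \<le> 1 * \<bar>hyp0F1_coeff a k\<bar>"
      unfolding s_def abs_mult by simp
  qed
  have s_nonneg: "(\<Sum>k. s k * x ^ k) \<ge> 0" for x
  proof -
    have scale: "4 ^ k * s k * (x / 4) ^ k = s k * x ^ k" for k
      by (simp add: power_divide)
    have "(\<lambda>k. s k * x ^ k) sums (\<Sum>k. hyp0F1_coeff c k * (x / 4) ^ k)\<^sup>2"
      using hyp0F1_square_series[OF c(1), of "x / 4"] by (simp only: scale flip: s_eq)
    then show ?thesis by (simp add: sums_iff)
  qed
  have \<mu>_int: "((\<lambda>t. t powr (c - 1) * (1 - t) powr (1 / 2 - 1) * t ^ k) has_integral \<mu> k) {0..1}" for k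
    unfolding \<mu>_def
  proof (rule has_integral_spike[OF negligible_sing[of 0] _ has_integral_Beta_real])
    fix t :: real assume "t \<in> {0..1} - {0}"
    then have "t > 0" by simp
    then have "t powr (c + real k - 1) = t powr (c - 1) * t ^ k"
      using powr_add[of t "c - 1" "real k"] by (simp add: powr_realpow algebra_simps)
    then show "t powr (c - 1) * (1 - t) powr (1 / 2 - 1) * t ^ k
        = t powr (c + real k - 1) * (1 - t) powr (1 / 2 - 1)" by simp
  qed (use c in auto)
  have \<mu>_eq: "\<mu> k = \<mu> 0 * (pochhammer c k / pochhammer (a / 2 + 1) k)" for k
  proof -
    have *: "Gamma (x + real k) = pochhammer x k * Gamma x" if "x > 0" for x :: real
    proof -
      have "x \<notin> \<int>\<^sub>\<le>\<^sub>0" using that by (auto elim!: nonpos_Ints_cases)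
      from pochhammer_Gamma[OF this, of k] show ?thesis
        using Gamma_real_pos[OF that] by simp
    qed
    have eq: "c + 1 / 2 = a / 2 + 1" by (simp add: c_def field_simps)
    then have eq': "c + real k + 1 / 2 = a / 2 + 1 + real k" by simp
    show ?thesis
      unfolding \<mu>_def Beta_def
      using a c(1) by (simp add: eq eq' * mult_ac)
  qed
  \<comment> \<open>The factor \<open>pochhammer c k\<close> cancels, and the quotient of Pochhammer
    symbols at a/2 and a/2 + 1 telescopes to a single linear denominator.\<close>
  have ratio: "s k * \<mu> k = \<mu> 0 * (a / 2) * (hyp0F1_coeff a k / (real k + a / 2))" for k
  proof -
    have "(a / 2 + real k) * pochhammer (a / 2) k = (a / 2) * pochhammer (a / 2 + 1) k"
      using pochhammer_rec[of "a / 2" k] pochhammer_rec'[of "a / 2" k] by simp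
    then have "pochhammer (a / 2) k / pochhammer (a / 2 + 1) k = (a / 2) / (real k + a / 2)"
      using pos[of k] a by (simp add: field_simps)
    moreover have "s k * \<mu> k = \<mu> 0 * hyp0F1_coeff a k * (pochhammer (a / 2) k / pochhammer (a / 2 + 1) k)"
      unfolding s_def \<mu>_eq[of k] using pos[of k] by simp
    ultimately show ?thesis by simp
  qed
  have \<mu>0: "\<mu> 0 > 0"
    using c(1) by (simp add: \<mu>_def Beta_def Gamma_real_pos)
  have summ: "summable (\<lambda>k. hyp0F1_coeff a k / (real k + a / 2) * y ^ k)"
    using entire_coeffs_divide[OF entire_coeffs_hyp0F1[OF a], of "a / 2"] a
    by (simp add: entire_coeffs_def)
  have term_eq: "s k * y ^ k * \<mu> k = \<mu> 0 * (a / 2) * (hyp0F1_coeff a k / (real k + a / 2) * y ^ k)" for k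
    using ratio[of k] by (metis mult.assoc mult.commute)
  \<comment> \<open>Absorbing \<open>y ^ k\<close> into the coefficients turns the series at t into
    the nonnegative one at \<open>y * t\<close>.\<close>
  have "(\<Sum>k. s k * y ^ k * \<mu> k) \<ge> 0"
  proof (rule moment_transform_nonneg[OF _ \<mu>_int])
    show "summable (\<lambda>k. \<bar>s k * y ^ k\<bar>)" by (rule entire_coeffs_abs[OF s])
    show "summable (\<lambda>k. s k * y ^ k * \<mu> k)"
      unfolding term_eq by (intro summable_mult summ)
    show "0 \<le> (\<Sum>k. s k * y ^ k * t ^ k)" for t
      using s_nonneg[of "y * t"] by (simp add: power_mult_distrib mult.assoc)
  qed auto
  then show ?thesis
    unfolding term_eq suminf_mult[OF summ] using zero_le_mult_iff[of "\<mu> 0 * (a / 2)"] mult_pos_pos[OF \<mu>0, of "a / 2"] a by auto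
qed

text \<open>Partial fractions write 1/(k + b) as 1/(k + a/2) plus (a/2 - b) / ((k + a/2)(k + b)).
  The first part gives a nonnegative series; the second is strictly positive by
  \<open>powser_divide_pos\<close>.\<close>

lemma hyp0F1_integral_pos:
  fixes a b y :: real
  assumes "0 < b" "b < a / 2" "y \<ge> 0"
  shows "(\<Sum>k. hyp0F1_coeff a k / (real k + b) * y ^ k) > 0"
proof -
  have a: "a > 0" using assms by simp
  define q where "q = (\<lambda>k. hyp0F1_coeff a k / (real k + a / 2))"
  have q: "entire_coeffs q"
    unfolding q_def using a by (intro entire_coeffs_divide entire_coeffs_hyp0F1) auto
  have q_nonneg: "(\<Sum>k. q k * x ^ k) \<ge> 0" if "x \<ge> 0" for x
    unfolding q_def by (rule hyp0F1_integral_nonneg[OF a that])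
  have "q 0 > 0" using a by (simp add: q_def hyp0F1_coeff_def)
  from powser_divide_pos[OF q assms(1) this q_nonneg assms(3)]
  have pos: "(\<Sum>k. q k / (real k + b) * y ^ k) > 0" .
  have "summable (\<lambda>k. q k * y ^ k)" "summable (\<lambda>k. q k / (real k + b) * y ^ k)"
    using q entire_coeffs_divide[OF q assms(1)] by (auto simp: entire_coeffs_def)
  then have "(\<lambda>k. q k * y ^ k + (a / 2 - b) * (q k / (real k + b) * y ^ k)) sums
      ((\<Sum>k. q k * y ^ k) + (a / 2 - b) * (\<Sum>k. q k / (real k + b) * y ^ k))"
    by (intro sums_add sums_mult summable_sums)
  moreover have "q k * y ^ k + (a / 2 - b) * (q k / (real k + b) * y ^ k)
      = hyp0F1_coeff a k / (real k + b) * y ^ k" for k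
  proof -
    have "real k + b > 0" "real k + a / 2 > 0" using assms a by (simp_all add: add_nonneg_pos)
    then have "1 / (real k + a / 2) + (a / 2 - b) * (1 / (real k + a / 2) / (real k + b)) = 1 / (real k + b)"
      by (simp add: divide_simps)
    then have "hyp0F1_coeff a k * y ^ k *
        (1 / (real k + a / 2) + (a / 2 - b) * (1 / (real k + a / 2) / (real k + b)))
      = hyp0F1_coeff a k * y ^ k * (1 / (real k + b))" by simp
    then show ?thesis by (simp add: q_def algebra_simps)
  qed
  ultimately have "(\<Sum>k. hyp0F1_coeff a k / (real k + b) * y ^ k) =
      (\<Sum>k. q k * y ^ k) + (a / 2 - b) * (\<Sum>k. q k / (real k + b) * y ^ k)"
    by (simp add: sums_iff)
  moreover have "(a / 2 - b) * (\<Sum>k. q k / (real k + b) * y ^ k) > 0"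
    using pos assms by simp
  ultimately show ?thesis using q_nonneg[OF assms(3)] by simp
qed

section \<open>Monotonicity of 2F3 in its parameter, and of the multiplier\<close>

lemma hyp2F3_strict_antimono:
  fixes b1 b2 p y :: real
  assumes b: "0 < b1" "b1 < b2" "b2 < (p + 1) / 2" and p: "p > 0" and y: "y > 0"
  shows "hyp2F3 1 (b2 - 1) 2 p b2 (- y) < hyp2F3 1 (b1 - 1) 2 p b1 (- y)"
proof -
  \<comment> \<open>The shift by one comes from dropping the zeroth term:
    \<open>pochhammer p (Suc k) = p * pochhammer (p + 1) k\<close>.\<close>
  define a where "a = p + 1"
  have a: "a > 0" "b1 < a / 2" "b2 > 0" using b p by (auto simp: a_def)
  define T where "T = (\<lambda>b j. (pochhammer 1 j * pochhammer (b - 1) j)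
      / (pochhammer 2 j * pochhammer p j * pochhammer b j) * ((- y) ^ j / fact j))"
  define S where "S = (\<lambda>k. hyp0F1_coeff a k / (real k + b1) / (real k + b2) / (real k + 2))"
  have T_Suc: "T b (Suc k) = - y / p / real (k + 1) * (hyp0F1_coeff a k / (real k + 2) * y ^ k) * ((b - 1) / (real k + b))"
    if "b > 0" for b k
  proof -
    have "pochhammer b k > 0" "pochhammer a k > 0" using that a by (auto intro!: pochhammer_pos)
    moreover have "pochhammer (b - 1) (Suc k) = (b - 1) * pochhammer b k"
      using pochhammer_rec[of "b - 1" k] by simp
    moreover have "pochhammer b (Suc k) = (real k + b) * pochhammer b k"
      using pochhammer_rec'[of b k] by (simp add: add.commute)
    moreover have "pochhammer p (Suc k) = p * pochhammer a k"
      using pochhammer_rec[of p k] by (simp add: a_def)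
    moreover have "pochhammer 1 (Suc k) = (fact (Suc k) :: real)"
      by (rule pochhammer_fact[symmetric])
    moreover have "pochhammer 2 (Suc k) = (real k + 2) * (real k + 1) * fact k"
      using pochhammer_rec[of "1::real" "Suc k"] pochhammer_fact[of "Suc (Suc k)", where 'a = real]
      by (simp add: algebra_simps)
    ultimately show ?thesis
      unfolding T_def hyp0F1_coeff_def power_minus[of y] using p by (simp add: mult_ac)
  qed
  have diff: "T b1 (Suc k) - T b2 (Suc k) = y * (b2 - b1) / p * (S k * y ^ k)" for k
  proof -
    define C where "C = hyp0F1_coeff a k / (real k + 2) * y ^ k"
    define B where "B = (real k + b1) * (real k + b2)"
    have nz: "real k + b1 \<noteq> 0" "real k + b2 \<noteq> 0" "real k + 1 \<noteq> 0" using b a(3) by linarith+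
    \<comment> \<open>The numerator produces exactly the factor \<open>k + 1\<close> that cancels
      the one left in \<open>T_Suc\<close>, so only three linear denominators remain.\<close>
    have ratio: "(b1 - 1) / (real k + b1) - (b2 - 1) / (real k + b2) = - (b2 - b1) * (real k + 1) / B"
      unfolding B_def using nz(1,2) by (simp add: diff_frac_eq) (simp add: algebra_simps)
    have "T b1 (Suc k) - T b2 (Suc k)
        = - y / p / real (k + 1) * C * ((b1 - 1) / (real k + b1) - (b2 - 1) / (real k + b2))"
      unfolding T_Suc[OF b(1)] T_Suc[OF a(3)] C_def[symmetric] by (simp add: right_diff_distrib)
    also have "\<dots> = y * (b2 - b1) / p * (C / B)"
      unfolding ratio using nz(3) by (simp add: divide_simps) (simp add: algebra_simps)
    also have "C / B = S k * y ^ k"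
      by (simp add: S_def C_def B_def mult_ac)
    finally show ?thesis .
  qed
  have sums_T: "T b sums hyp2F3 1 (b - 1) 2 p b (- y)" for b
    unfolding T_def hyp2F3_def by (intro summable_sums summable_hyp2F3)
  have "(\<lambda>j. T b1 j - T b2 j) sums (hyp2F3 1 (b1 - 1) 2 p b1 (- y) - hyp2F3 1 (b2 - 1) 2 p b2 (- y))"
    by (intro sums_diff sums_T)
  \<comment> \<open>Both zeroth terms equal 1, so the index shift leaves the sum unchanged.\<close>
  then have "(\<lambda>k. T b1 (Suc k) - T b2 (Suc k)) sums
      (hyp2F3 1 (b1 - 1) 2 p b1 (- y) - hyp2F3 1 (b2 - 1) 2 p b2 (- y))"
    by (subst sums_Suc_iff) (simp add: T_def)
  then have diff_sums: "(\<lambda>k. y * (b2 - b1) / p * (S k * y ^ k)) sums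
      (hyp2F3 1 (b1 - 1) 2 p b1 (- y) - hyp2F3 1 (b2 - 1) 2 p b2 (- y))"
    unfolding diff .
  \<comment> \<open>The factor at \<open>b1\<close> needs the Bessel argument; those at
    \<open>b2\<close> and 2 each follow from \<open>powser_divide_pos\<close>.\<close>
  have S_pos: "(\<Sum>k. S k * y ^ k) > 0"
  proof -
    have c1: "entire_coeffs (\<lambda>k. hyp0F1_coeff a k / (real k + b1))"
      using a b by (intro entire_coeffs_divide entire_coeffs_hyp0F1)
    have pos1: "(\<Sum>k. hyp0F1_coeff a k / (real k + b1) / (real k + b2) * x ^ k) > 0" if "x \<ge> 0" for x
      using hyp0F1_integral_pos[OF b(1) a(2)] b(1) that
      by (intro powser_divide_pos[OF c1 a(3)]) (auto simp: hyp0F1_coeff_def less_imp_le)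
    show ?thesis
      unfolding S_def using pos1 b(1) a(3) y
      by (intro powser_divide_pos[OF entire_coeffs_divide[OF c1 a(3)]])
         (auto simp: hyp0F1_coeff_def less_imp_le)
  qed
  have "summable (\<lambda>k. S k * y ^ k)"
    using entire_coeffs_divide[OF entire_coeffs_divide[OF entire_coeffs_divide[OF
        entire_coeffs_hyp0F1[OF a(1)] b(1)] a(3)], of 2]
    by (simp add: entire_coeffs_def S_def)
  from diff_sums have "hyp2F3 1 (b1 - 1) 2 p b1 (- y) - hyp2F3 1 (b2 - 1) 2 p b2 (- y)
      = y * (b2 - b1) / p * (\<Sum>k. S k * y ^ k)"
    using suminf_mult[OF \<open>summable (\<lambda>k. S k * y ^ k)\<close>, of "y * (b2 - b1) / p"]
    by (simp only: sums_iff)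
  also have "\<dots> > 0" using S_pos b y p by simp
  finally show ?thesis by simp
qed

theorem lemma1:
  fixes \<delta> :: real and \<nu> :: "real ^ 'n"
  assumes "\<delta> > 0" and "\<nu> \<noteq> 0"
  shows "strict_antimono_on {(real CARD('n) + 4) / 2 <..< real CARD('n) + 4}
           (\<lambda>\<beta>. multiplier \<delta> \<beta> \<nu>)"
proof (rule monotone_onI)
  fix \<beta>1 \<beta>2 :: real
  let ?n = "real CARD('n)"
  let ?F = "\<lambda>\<beta>. hyp2F3 1 ((?n + 2 - \<beta>) / 2) 2 ((?n + 2) / 2) ((?n + 4 - \<beta>) / 2)
              (- (1 / 4) * (norm \<nu>)\<^sup>2 * \<delta>\<^sup>2)"
  assume \<beta>: "\<beta>1 \<in> {(?n + 4) / 2 <..< ?n + 4}" "\<beta>2 \<in> {(?n + 4) / 2 <..< ?n + 4}" "\<beta>1 < \<beta>2"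
  have shift: "(?n + 2 - \<beta>) / 2 = (?n + 4 - \<beta>) / 2 - 1" for \<beta> by (simp add: field_simps)
  \<comment> \<open>Larger \<beta> means smaller b, so the roles swap:
    \<open>b2 < (p + 1) / 2\<close> is the lower bound on \<open>\<beta>1\<close>, and
    \<open>0 < b1\<close> is the upper bound on \<open>\<beta>2\<close>.\<close>
  have "?F \<beta>1 < ?F \<beta>2"
    using hyp2F3_strict_antimono[of "(?n + 4 - \<beta>2) / 2" "(?n + 4 - \<beta>1) / 2" "(?n + 2) / 2"
        "1 / 4 * (norm \<nu>)\<^sup>2 * \<delta>\<^sup>2"] \<beta> assms
    unfolding shift by (simp add: field_simps)
  then show "multiplier \<delta> \<beta>2 \<nu> < multiplier \<delta> \<beta>1 \<nu>"
    using assms(2) by (simp add: multiplier_def)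
qed

end
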